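(* For every real number $\alpha>1$ the following two assertions hold. (i) (Upper bound.) There is a constant $A>0$ depending only on $\alpha$ such that every $\alpha$-evenly distributed finite point set $X$ in a unit disk in $\mathbb{R}^2$ satisfies $L(X)\le A\,|X|^{3/4}$; that is, $L(X)\le O(|X|^{3/4})$. (ii) (The growth rate cannot be improved.) There is a constant $c>0$ depending only on $\alpha$ such that there exist $\alpha$-evenly distributed finite point sets $X$ in a unit disk in $\mathbb{R}^2$, of arbitrarily large cardinality $|X|$, with $L(X)\ge c\,|X|^{3/4}$.
   Context: For a finite point set $X\subset\mathbb{R}^d$, let $V(X)$ be the set of extreme points of $X$, i.e. the vertices of the convex hull $\operatorname{conv}(X)$. The peeling sequence $\{X_i\}_{i\ge 1}$ of $X$ is defined by $X_1=X$ and $X_{i+1}=X_i\setminus V(X_i)$ for $i\ge 1$. The layer number is $L(X)=\min\{k: X_{k+1}=\emptyset\}$. For a constant $\alpha>1$, a finite point set $X$ contained in a unit ball (a ball of radius $1$) in $\mathbb{R}^d$ is called $\alpha$-evenly distributed if $$|X\cap D|\le \big\lceil \alpha\,|X|\operatorname{Vol}(D)\big\rceil$$ for every Euclidean ball $D$ in $\mathbb{R}^d$ with positive volume (any center, any positive radius), where $\operatorname{Vol}$ is the $d$-dimensional volume. Here $d=2$: unit disks in the plane, and $\operatorname{Vol}$ is area. *)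

theory Defs
  imports "HOL-Analysis.Analysis"
begin

definition extreme_points :: "'a::euclidean_space set \<Rightarrow> 'a set" where
  "extreme_points X = {x. x extreme_point_of (convex hull X)}"

(* Indexed from 1, so X_1 = X; the index 0 is unused (it also yields X). *)
definition peeling :: "'a::euclidean_space set \<Rightarrow> nat \<Rightarrow> 'a set" where
  "peeling X i = ((\<lambda>Y. Y - extreme_points Y) ^^ (i - 1)) X"

lemma peeling_1: "peeling X 1 = X"
  by (simp add: peeling_def)

lemma peeling_Suc:
  assumes "i \<ge> 1"
  shows "peeling X (Suc i) = peeling X i - extreme_points (peeling X i)"
  using assms by (cases i) (simp_all add: peeling_def)

(* k ranges over all naturals including 0, so the empty set has layer number 0. *)
definition layer_number :: "'a::euclidean_space set \<Rightarrow> nat" where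
  "layer_number X = (LEAST k. peeling X (k + 1) = {})"

lemma extreme_points_Int_nonempty:
  fixes X :: "'a::euclidean_space set"
  assumes "finite X" "X \<noteq> {}"
  shows "X \<inter> extreme_points X \<noteq> {}"
proof -
  have "convex hull X = convex hull (extreme_points X)"
    unfolding extreme_points_def
    using assms by (intro Krein_Milman_Minkowski)
      (auto intro: finite_imp_compact_convex_hull)
  then have "extreme_points X \<noteq> {}"
    using assms by auto
  moreover have "extreme_points X \<subseteq> X"
    unfolding extreme_points_def using extreme_point_of_convex_hull by blast
  ultimately show ?thesis by blast
qed

(* The set minimised over in layer_number is nonempty for finite X. *)
lemma peeling_layer_number:
  fixes X :: "'a::euclidean_space set"
  assumes "finite X"
  shows "peeling X (layer_number X + 1) = {}"
proof -
  have "finite (peeling X (k + 1)) \<and> card (peeling X (k + 1)) \<le> card X - k" for k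
  proof (induction k)
    case 0
    then show ?case using assms by (simp add: peeling_def)
  next
    case (Suc k)
    let ?Y = "peeling X (k + 1)"
    have eq: "peeling X (Suc k + 1) = ?Y - extreme_points ?Y"
      using peeling_Suc[of "k + 1" X] by simp
    show ?case
    proof (cases "?Y = {}")
      case True
      then show ?thesis using eq by simp
    next
      case False
      then have "?Y - extreme_points ?Y \<subset> ?Y"
        using extreme_points_Int_nonempty Suc.IH by blast
      then have "card (?Y - extreme_points ?Y) < card ?Y"
        using Suc.IH by (meson psubset_card_mono)
      then show ?thesis using eq Suc.IH by auto
    qed
  qed
  from this[of "card X"] have "peeling X (card X + 1) = {}"
    by (metis card_0_eq diff_self_eq_0 le_zero_eq)
  then show ?thesis unfolding layer_number_def by (rule LeastI)
qed

(* Balls are closed, both the unit ball containing X and the test balls D. For D this gives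
   the stronger condition: it implies the same bound for open balls, as the two have equal volume. *)
definition evenly_distributed :: "real \<Rightarrow> 'a::euclidean_space set \<Rightarrow> bool" where
  "evenly_distributed \<alpha> X \<longleftrightarrow>
     finite X \<and> (\<exists>z. X \<subseteq> cball z 1) \<and>
     (\<forall>z r. r > 0 \<longrightarrow>
        int (card (X \<inter> cball z r)) \<le> \<lceil>\<alpha> * real (card X) * measure lebesgue (cball z r)\<rceil>)"

end

(* Upper bound: by even distribution the points are delta-separated with delta of order n^(-1/2).
   Measure a convex polygon by the sum of its support function over K equally spaced directions
   (a discrete perimeter), with K of order n^(1/4). Peeling a layer with few vertices (fewer than
   about n^(1/4)) lowers this sum by at least delta, because a positive proportion of the
   directions lies well inside the normal cone of a vertex; a layer with many vertices uses up
   many points. Both kinds of layers therefore occur O(n^(3/4)) times.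

   Lower bound: with omega an m-th root of unity and zeta = (1 - 1/m) + omega/m, each of the
   m-gons zeta^i * {omega^k} has its vertices on the edges of the previous one, so k peelings
   leave all but the first k of them intact. The first m^3/4000 of them stay in the annulus 0.99 <= |w| <= 1 and
   are separated by order m^(-2). The disc |w| <= 0.985 is filled with a nearly hexagonal lattice
   of the same separation d: it is so dense that n * d^2 >= 3.4, and this together with
   separation already forces even distribution, even with alpha = 1. *)

theory Submission
  imports Defs
begin

section \<open>Upper bound\<close>

lemma measure_lebesgue_cball_2:
  fixes z :: "'a::euclidean_space"
  assumes "DIM('a) = 2" "r \<ge> 0"
  shows "measure lebesgue (cball z r) = pi * r\<^sup>2"
  using assms content_cball[OF \<open>r \<ge> 0\<close>, of z] by (simp add: unit_ball_vol_2)

lemma peeling_Suc': "peeling X (Suc (Suc k)) = peeling X (Suc k) - extreme_points (peeling X (Suc k))"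
  by (simp add: peeling_def)

lemma peeling_subset: "peeling X (Suc k) \<subseteq> X"
  by (induction k) (auto simp: peeling_1[simplified] peeling_Suc')

lemma peeling_nonempty:
  assumes "k < layer_number X"
  shows "peeling X (Suc k) \<noteq> {}"
  using assms not_less_Least[of k "\<lambda>k. peeling X (k + 1) = {}"] by (auto simp: layer_number_def)

lemma extreme_points_subset: "extreme_points X \<subseteq> X"
  unfolding extreme_points_def using extreme_point_of_convex_hull by blast

text \<open>The disc with the segment from \<open>x\<close> to \<open>y\<close> as diameter contains
  two points. If they were closer than this, \<alpha> times \<open>card X\<close> times its area
  would be below 1, so its ceiling would allow only one.\<close>

lemma evenly_distributed_separated:
  fixes X :: "'a::euclidean_space set"
  assumes ev: "evenly_distributed \<alpha> X" and "\<alpha> > 0" and dim: "DIM('a) = 2"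
    and xy: "x \<in> X" "y \<in> X" "x \<noteq> y"
  shows "2 / sqrt (\<alpha> * real (card X) * pi) \<le> dist x y"
proof (rule ccontr)
  assume "\<not> ?thesis"
  then have lt: "dist x y < 2 / sqrt (\<alpha> * real (card X) * pi)" by simp
  have fin: "finite X" using ev by (simp add: evenly_distributed_def)
  have c0: "card X > 0" using fin xy by (auto simp: card_gt_0_iff)
  define s where "s = \<alpha> * real (card X) * pi"
  have s: "s > 0" unfolding s_def using \<open>\<alpha> > 0\<close> c0 by simp
  define r where "r = dist x y / 2"
  have r: "r > 0" using xy by (simp add: r_def)
  have "{x, y} \<subseteq> X \<inter> cball (midpoint x y) r"
    using xy by (auto simp: r_def dist_midpoint)
  then have "card {x, y} \<le> card (X \<inter> cball (midpoint x y) r)"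
    using fin by (intro card_mono) auto
  then have "2 \<le> int (card (X \<inter> cball (midpoint x y) r))" using xy by simp
  also have "\<dots> \<le> \<lceil>\<alpha> * real (card X) * measure lebesgue (cball (midpoint x y) r)\<rceil>"
    using ev r by (auto simp: evenly_distributed_def)
  also have "\<alpha> * real (card X) * measure lebesgue (cball (midpoint x y) r) = s * r\<^sup>2"
    using r measure_lebesgue_cball_2[OF dim, of r "midpoint x y"] by (simp add: s_def)
  finally have "s * r\<^sup>2 > 1" by linarith
  moreover have "r < 1 / sqrt s" using lt by (simp add: r_def s_def)
  then have "r\<^sup>2 < (1 / sqrt s)\<^sup>2" using r by (intro power_strict_mono) auto
  then have "s * r\<^sup>2 < 1" using s by (simp add: power_divide field_simps)
  ultimately show False by simp
qed

text \<open>Sine is concave on [0, pi], so it lies above its chord from 0 to pi/2.\<close>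

lemma sin_ge_Jordan:
  fixes x :: real
  assumes "0 \<le> x" "x \<le> pi / 2"
  shows "2 * x / pi \<le> sin x"
proof -
  have "convex_on {0..pi} (\<lambda>x. - sin x)"
    by (rule f''_ge0_imp_convex[where f' = "\<lambda>x. - cos x" and f'' = sin])
       (auto intro!: derivative_eq_intros sin_ge_zero)
  then have "- sin ((1 - 2 * x / pi) *\<^sub>R 0 + (2 * x / pi) *\<^sub>R (pi / 2))
      \<le> (1 - 2 * x / pi) * (- sin 0) + (2 * x / pi) * (- sin (pi / 2))"
    using assms by (intro convex_onD) (auto simp: field_simps)
  then show ?thesis by simp
qed

section \<open>Normal cones of finite planar sets\<close>

definition direction :: "real \<Rightarrow> real ^ 2" where
  "direction t = vector [cos t, sin t]"

text \<open>For \<open>v\<close> in \<open>S\<close> this says that \<open>direction t\<close> lies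
  in the normal cone of the convex hull at \<open>v\<close>.\<close>

definition maximal_in :: "(real ^ 2) set \<Rightarrow> real ^ 2 \<Rightarrow> real \<Rightarrow> bool" where
  "maximal_in S v t \<longleftrightarrow> (\<forall>x\<in>S. x \<bullet> direction t \<le> v \<bullet> direction t)"

lemma inner_direction: "x \<bullet> direction t = x $ 1 * cos t + x $ 2 * sin t"
  by (simp add: direction_def inner_vec_def sum_2)

lemma norm_direction [simp]: "norm (direction t) = 1"
  by (simp add: norm_eq_1 inner_direction) (simp add: direction_def flip: power2_eq_square)

lemma maximal_in_periodic: "maximal_in S v (t + 2 * pi) = maximal_in S v t"
  by (simp add: maximal_in_def direction_def)

text \<open>Normal cones are convex: \<open>direction (t + b)\<close> is the combination of the two
  outer directions with coefficients \<open>sin (a - b) / sin a\<close> and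
  \<open>sin b / sin a\<close>. These are nonnegative because \<open>a < pi\<close>.\<close>

lemma maximal_in_between:
  assumes "maximal_in S v t" "maximal_in S v (t + a)" "0 < a" "a < pi" "0 \<le> b" "b \<le> a"
  shows "maximal_in S v (t + b)"
  unfolding maximal_in_def
proof
  fix x assume x: "x \<in> S"
  have id: "sin a * (y \<bullet> direction (t + b)) =
      sin (a - b) * (y \<bullet> direction t) + sin b * (y \<bullet> direction (t + a))" for y
  proof -
    have 1: "sin a * cos (t + b) = sin (a - b) * cos t + sin b * cos (t + a)"
      by (simp add: sin_diff cos_add algebra_simps)
    have "sin a * sin (t + b) - (sin (a - b) * sin t + sin b * sin (t + a)) = 0"
      by (simp add: sin_diff sin_add cos_add algebra_simps)
    then have 2: "sin a * sin (t + b) = sin (a - b) * sin t + sin b * sin (t + a)" by simp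
    have "sin a * (y \<bullet> direction (t + b)) = y $ 1 * (sin a * cos (t + b)) + y $ 2 * (sin a * sin (t + b))"
      by (simp add: inner_direction algebra_simps)
    then show ?thesis unfolding 1 2 by (simp add: inner_direction algebra_simps)
  qed
  have "sin a * (x \<bullet> direction (t + b)) \<le> sin a * (v \<bullet> direction (t + b))"
    unfolding id using assms x
    by (intro add_mono mult_left_mono sin_ge_zero) (auto simp: maximal_in_def)
  then show "x \<bullet> direction (t + b) \<le> v \<bullet> direction (t + b)"
    using sin_gt_zero[of a] assms by simp
qed

text \<open>Since \<open>v - x\<close> has nonnegative inner product with the directions at
  \<open>t - a\<close> and \<open>t + a\<close>, its angle to \<open>direction t\<close> is at most
  \<open>pi / 2 - a\<close>. Its component along \<open>direction t\<close> is therefore at least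
  its length times \<open>sin a\<close>.\<close>

lemma maximal_in_gap:
  assumes "maximal_in S v (t - a)" "maximal_in S v (t + a)" "maximal_in S v t"
    and "0 \<le> a" "a < pi / 2" and x: "x \<in> S" and d: "d \<le> dist x v" and "d \<ge> 0"
  shows "d * sin a \<le> (v - x) \<bullet> direction t"
proof -
  define p where "p = (v - x) \<bullet> direction t"
  \<comment> \<open>\<open>p\<close> and \<open>q\<close> are the coordinates of
    \<open>v - x\<close> in the orthonormal frame rotated by \<open>t\<close>.\<close>
  define q where "q = (v - x) $ 2 * cos t - (v - x) $ 1 * sin t"
  have p0: "p \<ge> 0" using assms by (simp add: p_def inner_diff_left maximal_in_def)
  have e1: "(v - x) \<bullet> direction (t - a) = p * cos a - q * sin a"
    by (simp add: inner_direction p_def q_def sin_diff cos_diff algebra_simps)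
  have e2: "(v - x) \<bullet> direction (t + a) = p * cos a + q * sin a"
    by (simp add: inner_direction p_def q_def sin_add cos_add algebra_simps)
  have "0 \<le> (v - x) \<bullet> direction (t - a)" "0 \<le> (v - x) \<bullet> direction (t + a)"
    using assms by (simp_all add: inner_diff_left maximal_in_def)
  then have "\<bar>q * sin a\<bar> \<le> p * cos a" using e1 e2 by linarith
  then have "(q * sin a)\<^sup>2 \<le> (p * cos a)\<^sup>2" by (metis abs_le_square_iff abs_of_nonneg abs_ge_zero order_trans)
  then have "p\<^sup>2 * (sin a)\<^sup>2 + q\<^sup>2 * (sin a)\<^sup>2 \<le> p\<^sup>2 * (sin a)\<^sup>2 + p\<^sup>2 * (cos a)\<^sup>2"
    by (simp add: power_mult_distrib)
  also have "\<dots> = p\<^sup>2 * ((sin a)\<^sup>2 + (cos a)\<^sup>2)" by (simp only: distrib_left)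
  finally have 1: "(p\<^sup>2 + q\<^sup>2) * (sin a)\<^sup>2 \<le> p\<^sup>2" by (simp add: distrib_right)
  have "(A * cos t + B * sin t)\<^sup>2 + (B * cos t - A * sin t)\<^sup>2 = (A\<^sup>2 + B\<^sup>2) * ((sin t)\<^sup>2 + (cos t)\<^sup>2)"
    for A B :: real by algebra
  then have "p\<^sup>2 + q\<^sup>2 = ((v - x) $ 1)\<^sup>2 + ((v - x) $ 2)\<^sup>2"
    by (simp add: p_def q_def inner_direction)
  also have "\<dots> = (dist x v)\<^sup>2"
    by (simp only: dist_norm norm_minus_commute[of x v] power2_norm_eq_inner inner_vec_def sum_2)
       (simp add: power2_eq_square)
  finally have 2: "p\<^sup>2 + q\<^sup>2 = (dist x v)\<^sup>2" .
  have "(d * sin a)\<^sup>2 \<le> (dist x v)\<^sup>2 * (sin a)\<^sup>2"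
    using d \<open>d \<ge> 0\<close> by (simp add: power_mult_distrib mult_right_mono power_mono)
  also have "\<dots> \<le> p\<^sup>2" using 1 2 by simp
  finally show ?thesis using p0 power2_le_imp_le by (auto simp: p_def)
qed

lemma finite_has_maximal_in_image:
  fixes f :: "'a \<Rightarrow> real"
  assumes "finite S" "S \<noteq> {}"
  obtains x where "x \<in> S" "\<And>y. y \<in> S \<Longrightarrow> f y \<le> f x"
proof -
  have "Max (f ` S) \<in> f ` S" using assms by (intro Max_in) auto
  then obtain x where x: "x \<in> S" "Max (f ` S) = f x" by blast
  have "f y \<le> f x" if "y \<in> S" for y
    using assms that Max_ge[of "f ` S" "f y"] x by simp
  then show ?thesis using that x by blast
qed

text \<open>The best extreme point bounds a half-plane containing all extreme points, hence their
  hull, hence \<open>S\<close>.\<close>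

lemma extreme_points_maximal_in:
  assumes "finite S" "S \<noteq> {}"
  shows "\<exists>v\<in>extreme_points S. maximal_in S v t"
proof -
  let ?V = "extreme_points S"
  have V: "finite ?V" "?V \<noteq> {}"
    using assms extreme_points_subset[of S] extreme_points_Int_nonempty[of S] by (auto intro: finite_subset)
  obtain v where v: "v \<in> ?V" "\<And>y. y \<in> ?V \<Longrightarrow> y \<bullet> direction t \<le> v \<bullet> direction t"
    using finite_has_maximal_in_image[OF V, of "\<lambda>y. y \<bullet> direction t"] by metis
  have hull: "convex hull S = convex hull ?V"
    unfolding extreme_points_def using assms
    by (intro Krein_Milman_Minkowski) (auto intro: finite_imp_compact_convex_hull)
  have "convex hull ?V \<subseteq> {x. direction t \<bullet> x \<le> v \<bullet> direction t}"
    using v by (intro hull_minimal convex_halfspace_le) (auto simp: inner_commute)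
  then have "maximal_in S v t"
    unfolding maximal_in_def using hull hull_subset[of S convex] by (auto simp: inner_commute)
  then show ?thesis using v by blast
qed

section \<open>The support function summed over equally spaced directions\<close>

definition support :: "(real ^ 2) set \<Rightarrow> real \<Rightarrow> real" where
  "support S t = Max ((\<lambda>x. x \<bullet> direction t) ` S)"

lemma support_mono:
  assumes "finite S" "T \<subseteq> S" "T \<noteq> {}"
  shows "support T t \<le> support S t"
  unfolding support_def using assms by (intro Max_mono) auto

lemma support_ge: "finite S \<Longrightarrow> x \<in> S \<Longrightarrow> x \<bullet> direction t \<le> support S t"
  unfolding support_def by (intro Max_ge) auto

lemma support_attained:
  assumes "finite S" "S \<noteq> {}"
  obtains x where "x \<in> S" "support S t = x \<bullet> direction t"
proof -
  have "support S t \<in> (\<lambda>x. x \<bullet> direction t) ` S"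
    unfolding support_def using assms by (intro Max_in) auto
  then show ?thesis using that by blast
qed

lemma support_cball:
  assumes "finite S" "S \<noteq> {}" "S \<subseteq> cball z 1"
  shows "\<bar>support S t - z \<bullet> direction t\<bar> \<le> 1"
proof -
  obtain x where x: "x \<in> S" "support S t = x \<bullet> direction t" using support_attained assms by metis
  have "\<bar>(x - z) \<bullet> direction t\<bar> \<le> norm (x - z) * norm (direction t)" by (rule Cauchy_Schwarz_ineq2)
  also have "\<dots> \<le> 1" using x assms by (auto simp: dist_norm norm_minus_commute)
  finally show ?thesis using x by (simp add: inner_diff_left)
qed

definition angle :: "nat \<Rightarrow> nat \<Rightarrow> real" where
  "angle K j = 2 * pi * real j / real K"

text \<open>Each vertex owns a cyclic interval of directions. \<open>K\<close> is odd so that no two of the directions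
  are antipodal: in the plane two antipodal directions do not determine the arc between them.\<close>

lemma maximal_in_cyclic_interval:
  assumes K: "odd K" "K \<ge> 5" and "j < k" "k < K"
    and max: "maximal_in S v (angle K j)" "maximal_in S v (angle K k)"
  shows "maximal_in S v (angle K j + 2 * pi / K) \<and> maximal_in S v (angle K k - 2 * pi / K)
    \<or> maximal_in S v (angle K k + 2 * pi / K) \<and> maximal_in S v (angle K j - 2 * pi / K)"
proof -
  define t where "t = 2 * pi / K"
  define a where "a = real (k - j) * t"
  have K0: "real K > 0" using K by simp
  have t: "t > 0" "real K * t = 2 * pi" using K0 by (simp_all add: t_def)
  have ta: "t \<le> a" unfolding a_def using assms t by simp
  have "real (k - j) + 1 \<le> real K" using assms by linarith
  then have at: "a + t \<le> 2 * pi"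
    using t mult_right_mono[of "real (k - j) + 1" "real K" t] by (simp add: a_def algebra_simps)
  have ak: "angle K k = angle K j + a"
    using assms by (simp add: angle_def a_def t_def of_nat_diff field_simps)
  have "a \<noteq> pi"
  proof
    assume "a = pi"
    then have "2 * real (k - j) = real K" using K0 by (simp add: a_def t_def field_simps)
    then have "2 * (k - j) = K" by linarith
    then show False using K by auto
  qed
  then consider "a < pi" | "a > pi" by linarith
  then show ?thesis
  proof cases
    case 1
    have "maximal_in S v (angle K j + t)"
      by (rule maximal_in_between[where a = a]) (use 1 max ak t ta in auto)
    moreover have "maximal_in S v (angle K j + (a - t))"
      by (rule maximal_in_between[where a = a]) (use 1 max ak t ta in auto)
    ultimately show ?thesis using ak by (simp add: t_def algebra_simps)
  next
    case 2
    \<comment> \<open>Here the arc shorter than pi runs from index \<open>k\<close> through the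
      wrap-around to index \<open>j\<close>, one full turn later.\<close>
    have *: "maximal_in S v (angle K k + (2 * pi - a))"
      using max(1) maximal_in_periodic[of S v "angle K j"] ak by (simp add: algebra_simps)
    have "maximal_in S v (angle K k + t)"
      by (rule maximal_in_between[OF max(2) *]) (use 2 ak t ta at in auto)
    moreover have "maximal_in S v (angle K k + (2 * pi - a - t))"
      by (rule maximal_in_between[OF max(2) *]) (use 2 ak t ta at in auto)
    then have "maximal_in S v ((angle K j - t) + 2 * pi)"
      using ak by (simp add: algebra_simps)
    ultimately show ?thesis unfolding maximal_in_periodic by (simp add: t_def)
  qed
qed

text \<open>Each direction is assigned a vertex maximal in it. In all but at most
  \<open>2 * card (extreme_points S)\<close> directions this vertex is also maximal in both
  neighbouring directions, and there \<open>maximal_in_gap\<close> bounds the drop from below. In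
  the others the support does not increase.\<close>

lemma sum_support_decrease:
  assumes fin: "finite S" and sep: "\<And>x y. x \<in> S \<Longrightarrow> y \<in> S \<Longrightarrow> x \<noteq> y \<Longrightarrow> \<delta> \<le> dist x y" and "\<delta> \<ge> 0"
    and ne: "S - extreme_points S \<noteq> {}" and K: "odd K" "K \<ge> 5"
  shows "(real K - 2 * real (card (extreme_points S))) * (\<delta> * sin (2 * pi / K))
    \<le> (\<Sum>j<K. support S (angle K j)) - (\<Sum>j<K. support (S - extreme_points S) (angle K j))"
proof -
  let ?V = "extreme_points S" let ?T = "S - ?V"
  define t where "t = 2 * pi / K"
  have t: "0 \<le> t" "t < pi / 2" using K by (auto simp: t_def field_simps)
  have "\<exists>v. \<forall>j. v j \<in> ?V \<and> maximal_in S (v j) (angle K j)"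
    using extreme_points_maximal_in[OF fin] ne by (intro choice) blast
  then obtain v where v: "\<And>j. v j \<in> ?V" "\<And>j. maximal_in S (v j) (angle K j)" by blast
  have finV: "finite ?V" using fin extreme_points_subset finite_subset by blast
  \<comment> \<open>\<open>P\<close> collects the last directions of the intervals owned by the
    vertices and \<open>M\<close> the first ones. By \<open>maximal_in_cyclic_interval\<close> no
    vertex has two directions in \<open>P\<close>, nor two in \<open>M\<close>.\<close>
  define P where "P = {j \<in> {..<K}. \<not> maximal_in S (v j) (angle K j + t)}"
  define M where "M = {j \<in> {..<K}. \<not> maximal_in S (v j) (angle K j - t)}"
  have "inj_on v P"
  proof (rule linorder_inj_onI')
    fix j k assume "j \<in> P" "k \<in> P" "j < k"
    then show "v j \<noteq> v k"
      using maximal_in_cyclic_interval[OF K, of j k S "v j"] v(2)[of j] v(2)[of k]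
      by (auto simp: P_def t_def)
  qed
  then have P: "card P \<le> card ?V" using v finV by (intro card_inj_on_le) auto
  have "inj_on v M"
  proof (rule linorder_inj_onI')
    fix j k assume "j \<in> M" "k \<in> M" "j < k"
    then show "v j \<noteq> v k"
      using maximal_in_cyclic_interval[OF K, of j k S "v j"] v(2)[of j] v(2)[of k]
      by (auto simp: M_def t_def)
  qed
  then have M: "card M \<le> card ?V" using v finV by (intro card_inj_on_le) auto
  define G where "G = {..<K} - (P \<union> M)"
  have "card {..<K} - card (P \<union> M) \<le> card G"
    unfolding G_def by (rule diff_card_le_card_Diff) (auto simp: P_def M_def)
  moreover have "card (P \<union> M) \<le> card P + card M" by (rule card_Un_le)
  ultimately have G: "real K - 2 * real (card ?V) \<le> real (card G)" using P M by simp
  have mono: "support ?T s \<le> support S s" for s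
    using fin ne by (intro support_mono) auto
  have good: "\<delta> * sin t \<le> support S (angle K j) - support ?T (angle K j)" if j: "j \<in> G" for j
  proof -
    obtain x where x: "x \<in> ?T" "support ?T (angle K j) = x \<bullet> direction (angle K j)"
      using support_attained[of ?T] fin ne by blast
    have vS: "v j \<in> S" using v extreme_points_subset by blast
    then have "\<delta> \<le> dist x (v j)" using x v(1)[of j] by (intro sep) auto
    then have "\<delta> * sin t \<le> (v j - x) \<bullet> direction (angle K j)"
      using j v(2)[of j] x t \<open>\<delta> \<ge> 0\<close> by (intro maximal_in_gap[where S = S]) (auto simp: G_def P_def M_def)
    also have "\<dots> \<le> support S (angle K j) - support ?T (angle K j)"
      using support_ge[OF fin vS] x by (simp add: inner_diff_left)
    finally show ?thesis .
  qed
  have s0: "0 \<le> \<delta> * sin t" using t \<open>\<delta> \<ge> 0\<close> by (intro mult_nonneg_nonneg sin_ge_zero) auto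
  have "(real K - 2 * real (card ?V)) * (\<delta> * sin t) \<le> real (card G) * (\<delta> * sin t)"
    using G s0 by (rule mult_right_mono)
  also have "\<dots> = (\<Sum>j\<in>G. \<delta> * sin t)" by simp
  also have "\<dots> \<le> (\<Sum>j\<in>G. support S (angle K j) - support ?T (angle K j))"
    by (rule sum_mono) (rule good)
  also have "\<dots> \<le> (\<Sum>j<K. support S (angle K j) - support ?T (angle K j))"
    using mono by (intro sum_mono2) (auto simp: G_def)
  finally show ?thesis by (simp add: sum_subtractf t_def)
qed

text \<open>The potential \<open>\<Psi>\<close> adds the number of remaining points in units of
  \<open>m\<close> to the discrete perimeter in units of \<delta>. Every peeling with a nonempty
  remainder lowers it by at least 1, while its total variation is O(n^(3/4)).\<close>

lemma layer_number_upper_bound: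
  fixes X :: "(real ^ 2) set"
  assumes ev: "evenly_distributed \<alpha> X" and "\<alpha> > 0"
  shows "real (layer_number X) \<le> (2 + 10 * sqrt (\<alpha> * pi)) * real (card X) powr (3/4)"
proof (cases "X = {}")
  case True
  have "layer_number X = 0" unfolding layer_number_def
    by (rule Least_equality) (use True in \<open>auto simp: peeling_def\<close>)
  then show ?thesis using True by simp
next
  case False
  obtain z where fin: "finite X" and z: "X \<subseteq> cball z 1" using ev by (auto simp: evenly_distributed_def)
  define n where "n = real (card X)"
  have n1: "n \<ge> 1" unfolding n_def using fin False by (simp add: Suc_leI card_gt_0_iff)
  define \<delta> where "\<delta> = 2 / sqrt (\<alpha> * n * pi)"
  have d0: "\<delta> > 0" using \<open>\<alpha> > 0\<close> n1 by (simp add: \<delta>_def)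
  \<comment> \<open>The choice n^(1/4) balances \<open>n / m\<close>, from layers with many
    vertices, against \<open>K / \<delta>\<close>, of order m * n^(1/2), from layers with
    few.\<close>
  define m where "m = nat \<lceil>n powr (1/4)\<rceil>"
  have np: "n powr (1/4) \<ge> 1" using n1 by (simp add: ge_one_powr_ge_zero)
  have m: "n powr (1/4) \<le> real m" "real m \<le> n powr (1/4) + 1"
    using np unfolding m_def by linarith+
  have m1: "m \<ge> 1" using m np by linarith
  \<comment> \<open>Odd, and large enough that more than \<open>2 * m\<close> directions remain good
    when a layer has fewer than \<open>m\<close> vertices.\<close>
  define K where "K = 4 * m + 1"
  have K: "odd K" "K \<ge> 5" using m1 by (auto simp: K_def)
  have sinK: "4 / real K \<le> sin (2 * pi / K)"
    using sin_ge_Jordan[of "2 * pi / real K"] K by (simp add: field_simps)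
  define P where "P k = peeling X (Suc k)" for k
  have Psub: "P k \<subseteq> X" for k unfolding P_def by (rule peeling_subset)
  have Pfin: "finite (P k)" for k using Psub fin finite_subset by blast
  define \<Phi> where "\<Phi> k = (\<Sum>j<K. support (P k) (angle K j))" for k
  define \<Psi> where "\<Psi> k = real (card (P k)) / real m + \<Phi> k / \<delta>" for k
  define L where "L = layer_number X"
  have Pne: "P k \<noteq> {}" if "k < L" for k
    using that peeling_nonempty unfolding P_def L_def by blast
  \<comment> \<open>The last peeling is excluded, since \<open>support\<close> carries no
    information for the empty set.\<close>
  have step: "\<Psi> (Suc k) + 1 \<le> \<Psi> k" if k: "Suc k < L" for k
  proof -
    let ?V = "extreme_points (P k)"
    have PS: "P (Suc k) = P k - ?V" unfolding P_def by (rule peeling_Suc')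
    have ne: "P k - ?V \<noteq> {}" using Pne[OF k] PS by simp
    have dec: "(real K - 2 * real (card ?V)) * (\<delta> * sin (2 * pi / K)) \<le> \<Phi> k - \<Phi> (Suc k)"
      unfolding \<Phi>_def PS
    proof (rule sum_support_decrease[OF Pfin _ _ ne K])
      show "\<delta> \<le> dist x y" if "x \<in> P k" "y \<in> P k" "x \<noteq> y" for x y
        unfolding \<delta>_def n_def using that Psub
        by (intro evenly_distributed_separated[OF ev]) (auto simp: \<open>\<alpha> > 0\<close>)
    qed (use d0 in auto)
    have mono: "\<Phi> (Suc k) \<le> \<Phi> k"
      unfolding \<Phi>_def PS using Pfin ne by (intro sum_mono support_mono) auto
    have "card (P (Suc k)) = card (P k) - card ?V" "card ?V \<le> card (P k)"
      unfolding PS using Pfin extreme_points_subset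
      by (auto intro!: card_Diff_subset card_mono intro: finite_subset)
    then have cardS: "real (card (P (Suc k))) = real (card (P k)) - real (card ?V)" by simp
    show ?thesis
    proof (cases "m \<le> card ?V")
      case True
      have "real (card (P (Suc k))) / m + 1 \<le> real (card (P k)) / m"
        using True m1 by (simp add: cardS field_simps)
      moreover have "\<Phi> (Suc k) / \<delta> \<le> \<Phi> k / \<delta>" using mono d0 by (simp add: divide_right_mono)
      ultimately show ?thesis by (simp add: \<Psi>_def)
    next
      case False
      have "real (card (P (Suc k))) / m \<le> real (card (P k)) / m"
        using cardS by (simp add: divide_right_mono)
      moreover have "\<delta> \<le> \<Phi> k - \<Phi> (Suc k)"
      proof -
        have "\<delta> * 1 \<le> \<delta> * (2 * real m * (4 / real K))"
          using d0 m1 by (intro mult_left_mono) (auto simp: K_def field_simps)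
        also have "\<dots> = (2 * real m) * (\<delta> * (4 / real K))" by simp
        also have "\<dots> \<le> (real K - 2 * real (card ?V)) * (\<delta> * sin (2 * pi / K))"
          using sinK d0 False by (intro mult_mono mult_left_mono) (auto simp: K_def)
        finally show ?thesis using dec by simp
      qed
      then have "\<delta> / \<delta> \<le> (\<Phi> k - \<Phi> (Suc k)) / \<delta>" using d0 by (intro divide_right_mono) auto
      then have "\<Phi> (Suc k) / \<delta> + 1 \<le> \<Phi> k / \<delta>" using d0 by (simp add: diff_divide_distrib)
      ultimately show ?thesis by (simp add: \<Psi>_def)
    qed
  qed
  have tel: "k < L \<Longrightarrow> \<Psi> k + real k \<le> \<Psi> 0" for k
  proof (induction k)
    case (Suc k)
    then show ?case using step[of k] by simp
  qed simp
  show ?thesis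
  proof (cases "L = 0")
    case True
    then show ?thesis using \<open>\<alpha> > 0\<close> by (simp add: L_def)
  next
    case False
    \<comment> \<open>Index of the last nonempty set; the one peeling not covered by
      \<open>step\<close> accounts for the summand 1 below.\<close>
    define k where "k = L - 1"
    have k: "k < L" "real L = real k + 1" using False by (auto simp: k_def)
    \<comment> \<open>Relative to the centre \<open>z\<close> every support value lies in [-1, 1],
      and the shift by \<open>z\<close> is the same for all \<open>i\<close>, so it cancels in
      \<open>\<Phi> 0 - \<Phi> k\<close>.\<close>
    have bnd: "\<bar>\<Phi> i - (\<Sum>j<K. z \<bullet> direction (angle K j))\<bar> \<le> real K" if "i < L" for i
    proof -
      have "\<bar>\<Phi> i - (\<Sum>j<K. z \<bullet> direction (angle K j))\<bar>
          \<le> (\<Sum>j<K. \<bar>support (P i) (angle K j) - z \<bullet> direction (angle K j)\<bar>)"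
        unfolding \<Phi>_def sum_subtractf[symmetric] by (rule sum_abs)
      also have "\<dots> \<le> (\<Sum>j<K. 1)"
        using Pfin Pne[OF that] Psub z by (intro sum_mono support_cball) auto
      finally show ?thesis by simp
    qed
    have "\<Phi> 0 - \<Phi> k \<le> 2 * real K" using bnd[of 0] bnd[of k] k by linarith
    then have "\<Phi> 0 / \<delta> - \<Phi> k / \<delta> \<le> 2 * real K / \<delta>"
      using d0 by (simp add: divide_right_mono flip: diff_divide_distrib)
    moreover have "real (card (P 0)) / m - real (card (P k)) / m \<le> n / m"
    proof -
      have "P 0 = X" by (simp add: P_def peeling_1[simplified])
      then show ?thesis by (simp add: n_def)
    qed
    ultimately have "real L \<le> 1 + n / m + 2 * real K / \<delta>"
      using tel[OF k(1)] k by (simp add: \<Psi>_def)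
    moreover have "n / m \<le> n powr (3/4)"
    proof -
      have "n / m \<le> n / n powr (1/4)" using m np n1 m1 by (intro divide_left_mono) auto
      also have "\<dots> = n powr (1 - 1/4)" using n1 by (subst powr_diff) auto
      finally show ?thesis by simp
    qed
    moreover have "2 * real K / \<delta> \<le> 10 * sqrt (\<alpha> * pi) * n powr (3/4)"
    proof -
      have eq: "sqrt n * n powr (1/4) = n powr (3/4)"
        using n1 by (simp add: powr_half_sqrt[symmetric] flip: powr_add)
      have "real K \<le> 5 * real m" using m1 by (simp add: K_def)
      also have "\<dots> \<le> 10 * n powr (1/4)" using m np by simp
      finally have "2 * real K / \<delta> \<le> 2 * (10 * n powr (1/4)) / \<delta>"
        using d0 by (intro divide_right_mono) auto
      also have "\<dots> = 10 * sqrt (\<alpha> * pi) * (sqrt n * n powr (1/4))"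
        by (simp add: \<delta>_def real_sqrt_mult)
      finally show ?thesis by (simp add: eq)
    qed
    moreover have "1 \<le> n powr (3/4)" using n1 by (simp add: ge_one_powr_ge_zero)
    ultimately show ?thesis by (simp add: L_def n_def distrib_right)
  qed
qed

section \<open>Separated dense sets are evenly distributed\<close>

text \<open>With N points, the squared distances over all ordered pairs sum to 2N times the sum of
  |x - c|^2, minus a square, so to at most 2 N^2 R^2. Each of the N(N - 1) proper pairs contributes
  at least d^2.\<close>

lemma pairwise_dist_lower_bound_Rankin:
  fixes S :: "'a::euclidean_space set"
  assumes "finite S" "S \<subseteq> cball c R" "S \<noteq> {}"
    and sep: "\<And>x y. x \<in> S \<Longrightarrow> y \<in> S \<Longrightarrow> x \<noteq> y \<Longrightarrow> d \<le> dist x y" and "d \<ge> 0"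
  shows "(real (card S) - 1) * d\<^sup>2 \<le> 2 * real (card S) * R\<^sup>2"
proof -
  let ?N = "real (card S)"
  define g where "g x = x - c" for x
  have "(\<Sum>x\<in>S. \<Sum>y\<in>S. (dist x y)\<^sup>2) = (\<Sum>x\<in>S. \<Sum>y\<in>S. (norm (g x))\<^sup>2 + (norm (g y))\<^sup>2 - 2 * (g x \<bullet> g y))"
    by (intro sum.cong refl) (simp add: dist_norm g_def power2_norm_eq_inner inner_diff inner_commute algebra_simps)
  also have "\<dots> = 2 * ?N * (\<Sum>x\<in>S. (norm (g x))\<^sup>2) - 2 * ((\<Sum>x\<in>S. g x) \<bullet> (\<Sum>x\<in>S. g x))"
    by (simp add: sum.distrib sum_subtractf inner_sum_left inner_sum_right flip: sum_distrib_left) (rule sum.swap)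
  also have "\<dots> \<le> 2 * ?N * (\<Sum>x\<in>S. (norm (g x))\<^sup>2)" by simp
  also have "\<dots> \<le> 2 * ?N * (\<Sum>x\<in>S. R\<^sup>2)"
    using assms(2) by (intro mult_left_mono sum_mono power_mono) (auto simp: g_def dist_norm norm_minus_commute)
  finally have up: "(\<Sum>x\<in>S. \<Sum>y\<in>S. (dist x y)\<^sup>2) \<le> ?N * (2 * ?N * R\<^sup>2)" by simp
  have "?N * ((?N - 1) * d\<^sup>2) = (\<Sum>x\<in>S. \<Sum>y\<in>S - {x}. d\<^sup>2)"
    using assms(1,3) by (simp add: card_Diff_singleton of_nat_diff Suc_leI card_gt_0_iff)
  also have "\<dots> \<le> (\<Sum>x\<in>S. \<Sum>y\<in>S - {x}. (dist x y)\<^sup>2)"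
    using sep \<open>d \<ge> 0\<close> by (intro sum_mono power_mono) auto
  also have "\<dots> \<le> (\<Sum>x\<in>S. \<Sum>y\<in>S. (dist x y)\<^sup>2)"
    using assms(1) by (intro sum_mono sum_mono2) auto
  finally have "?N * ((?N - 1) * d\<^sup>2) \<le> ?N * (2 * ?N * R\<^sup>2)" using up by simp
  then show ?thesis using assms(1,3) by (simp add: card_gt_0_iff)
qed

text \<open>The open balls of radius \<open>d / 2\<close> around the points are disjoint and lie in
  the ball of radius \<open>R + d / 2\<close>; volumes are compared.\<close>

lemma card_separated_packing:
  fixes S :: "'a::euclidean_space set"
  assumes fin: "finite S" and sub: "S \<subseteq> cball c R" and "R \<ge> 0" "d > 0"
    and sep: "\<And>x y. x \<in> S \<Longrightarrow> y \<in> S \<Longrightarrow> x \<noteq> y \<Longrightarrow> d \<le> dist x y"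
  shows "real (card S) * d ^ DIM('a) \<le> (2 * R + d) ^ DIM('a)"
proof -
  have disj: "disjoint_family_on (\<lambda>x. ball x (d / 2)) S"
    unfolding disjoint_family_on_def
  proof (intro ballI impI equals0I)
    fix x y z assume "x \<in> S" "y \<in> S" "x \<noteq> y" and z: "z \<in> ball x (d / 2) \<inter> ball y (d / 2)"
    then have "d \<le> dist x y" by (intro sep)
    then show False using z dist_triangle2[of x y z] by (auto simp: dist_commute)
  qed
  have "real (card S) * (unit_ball_vol DIM('a) * (d / 2) ^ DIM('a)) = (\<Sum>x\<in>S. measure lborel (ball x (d / 2)))"
    using \<open>d > 0\<close> by (simp add: content_ball)
  also have "\<dots> = measure lborel (\<Union>x\<in>S. ball x (d / 2))"
    using fin disj by (subst measure_finite_Union) (auto intro!: less_imp_neq[OF emeasure_lborel_ball_finite, unfolded infinity_ennreal_def])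
  also have "\<dots> \<le> measure lborel (cball c (R + d / 2))"
  proof (intro measure_mono_fmeasurable)
    show "(\<Union>x\<in>S. ball x (d / 2)) \<subseteq> cball c (R + d / 2)"
    proof
      fix y assume "y \<in> (\<Union>x\<in>S. ball x (d / 2))"
      then obtain x where "x \<in> S" "dist x y < d / 2" by auto
      then show "y \<in> cball c (R + d / 2)" using sub dist_triangle[of c y x] by fastforce
    qed
  qed (auto intro: borel_open fmeasurable_compact)
  also have "\<dots> = unit_ball_vol DIM('a) * (R + d / 2) ^ DIM('a)"
    using assms by (intro content_cball) auto
  finally have "real (card S) * (d / 2) ^ DIM('a) \<le> (R + d / 2) ^ DIM('a)"
    by (simp add: mult.left_commute)
  then have "2 ^ DIM('a) * (real (card S) * (d / 2) ^ DIM('a)) \<le> 2 ^ DIM('a) * (R + d / 2) ^ DIM('a)"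
    by (intro mult_left_mono) auto
  then show ?thesis by (simp add: power_divide flip: power_mult_distrib)
qed

text \<open>With \<open>n * d\<^sup>2\<close> at least \<open>3.4\<close> (the upper limit, attained by hexagonal packings, is
  \<open>2 * pi / sqrt 3\<close>, about \<open>3.63\<close>) the packing bound suffices for discs with at least five points, but
  not for fewer; Rankin's bound covers these.\<close>

lemma evenly_distributed_of_separated:
  fixes X :: "'a::euclidean_space set"
  assumes dim: "DIM('a) = 2" and fin: "finite X" and sub: "X \<subseteq> cball w 1"
    and sep: "\<And>x y. x \<in> X \<Longrightarrow> y \<in> X \<Longrightarrow> x \<noteq> y \<Longrightarrow> d \<le> dist x y"
    and "d > 0" and dense: "34 / 10 \<le> real (card X) * d\<^sup>2" and "\<alpha> \<ge> 1"
  shows "evenly_distributed \<alpha> X"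
  unfolding evenly_distributed_def
proof (intro conjI allI impI exI)
  fix z :: 'a and r :: real assume r: "r > 0"
  define S where "S = X \<inter> cball z r"
  have S: "finite S" "S \<subseteq> cball z r" using fin by (auto simp: S_def)
  have sepS: "x \<in> S \<Longrightarrow> y \<in> S \<Longrightarrow> x \<noteq> y \<Longrightarrow> d \<le> dist x y" for x y
    using sep by (auto simp: S_def)
  define N where "N = real (card S)"
  define n where "n = real (card X)"
  have n0: "n > 0" using dense \<open>d > 0\<close> unfolding n_def by (cases "card X = 0") auto
  define y where "y = n * (pi * r\<^sup>2)"
  have y0: "y > 0" using n0 r by (simp add: y_def)
  have pi: "pi \<ge> 3.14" using pi_approx by simp
  \<comment> \<open>This strict inequality is what a ceiling bound on the integer \<open>N\<close>
    amounts to.\<close>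
  have key: "N - 1 < y"
  proof -
    consider "S = {}" | "S \<noteq> {}" "card S \<le> 4" | "card S \<ge> 5" by force
    then show ?thesis
    proof cases
      case 1
      then show ?thesis using y0 by (simp add: N_def)
    next
      case 2
      have N1: "N \<ge> 1" "N \<le> 4" using 2 S by (auto simp: N_def Suc_leI card_gt_0_iff)
      have R: "(N - 1) * d\<^sup>2 \<le> 2 * N * r\<^sup>2"
        unfolding N_def using pairwise_dist_lower_bound_Rankin[OF S 2(1)] sepS \<open>d > 0\<close> by simp
      show ?thesis
      proof (cases "N = 1")
        case True
        then show ?thesis using y0 by simp
      next
        case False
        then have "N > 1" using N1 by simp
        \<comment> \<open>For two to four points Rankin's bound gives
          \<open>3.4 * (N - 1) \<le> 8 / pi * y\<close>, and 8 / pi is below 3.4.\<close>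
        have "(N - 1) * (34 / 10) \<le> (N - 1) * (n * d\<^sup>2)"
          using dense \<open>N > 1\<close> by (intro mult_left_mono) (auto simp: n_def)
        also have "\<dots> \<le> n * (2 * N * r\<^sup>2)"
          using R n0 by (simp add: mult.left_commute)
        also have "\<dots> \<le> n * (8 * r\<^sup>2)" using N1 n0 by (intro mult_left_mono mult_right_mono) auto
        also have "\<dots> = 8 / pi * y" by (simp add: y_def)
        also have "\<dots> < 34 / 10 * y" using y0 pi by (intro mult_strict_right_mono) (auto simp: field_simps)
        finally show ?thesis by simp
      qed
    next
      case 3
      define s where "s = sqrt N"
      have s: "s\<^sup>2 = N" "s \<ge> 0" by (auto simp: s_def N_def)
      have s5: "s \<ge> 2.23"
        unfolding s_def by (rule real_le_rsqrt) (use 3 in \<open>simp add: N_def power2_eq_square\<close>)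
      have "(s * d)\<^sup>2 \<le> (2 * r + d)\<^sup>2"
        using card_separated_packing[OF S _ \<open>d > 0\<close> sepS] r dim by (simp add: power_mult_distrib s N_def)
      then have "s * d \<le> 2 * r + d" using r \<open>d > 0\<close> by (simp add: power2_le_iff_abs_le)
      then have "(s - 1) * d \<le> 2 * r" by (simp add: algebra_simps)
      then have "((s - 1) * d)\<^sup>2 \<le> (2 * r)\<^sup>2" using s5 \<open>d > 0\<close> by (intro power_mono) auto
      then have 1: "(s - 1)\<^sup>2 * d\<^sup>2 \<le> 4 * r\<^sup>2" by (simp add: power_mult_distrib)
      \<comment> \<open>The factor 3.4 * 3.14 / 4 is 2.669, and s + 1 < 2.669 * (s - 1) holds once s
        exceeds about 2.199: true for the root of 5, false for that of 4.\<close>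
      have "(s - 1) * (s + 1) < (s - 1) * ((3.4 * 3.14 / 4) * (s - 1))"
        using s5 by (intro mult_strict_left_mono) auto
      also have "\<dots> = (s - 1)\<^sup>2 * 3.4 * 3.14 / 4" by (simp add: power2_eq_square)
      also have "\<dots> \<le> (s - 1)\<^sup>2 * (n * d\<^sup>2) * pi / 4"
        using dense pi by (intro divide_right_mono mult_mono mult_left_mono) (auto simp: n_def)
      also have "\<dots> = ((s - 1)\<^sup>2 * d\<^sup>2) * (n * pi / 4)" by simp
      also have "\<dots> \<le> (4 * r\<^sup>2) * (n * pi / 4)" using 1 n0 by (intro mult_right_mono) auto
      also have "\<dots> = y" by (simp add: y_def)
      finally show ?thesis using s by (simp add: power2_eq_square algebra_simps)
    qed
  qed
  have "measure lebesgue (cball z r) = pi * r\<^sup>2"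
    using r dim content_cball[of r z] by (simp add: unit_ball_vol_2)
  moreover have "y \<le> \<alpha> * y" using y0 \<open>\<alpha> \<ge> 1\<close> by simp
  ultimately have "real_of_int (int (card S)) - 1 < \<alpha> * real (card X) * measure lebesgue (cball z r)"
    using key by (simp add: N_def y_def n_def mult.assoc)
  then show "int (card (X \<inter> cball z r)) \<le> \<lceil>\<alpha> * real (card X) * measure lebesgue (cball z r)\<rceil>"
    by (simp add: S_def le_ceiling_iff)
qed (use fin sub in auto)

section \<open>A nearly hexagonal lattice\<close>

text \<open>The row height is \<open>7 / 8\<close> rather than the slightly smaller hexagonal value \<open>sqrt 3 / 2\<close>, to keep it
  rational. Rows are shifted by half steps, so the plane is tiled by rectangular bricks whose lower left
  corners are the lattice points.\<close>

definition brick_point :: "real \<Rightarrow> int \<Rightarrow> int \<Rightarrow> complex" where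
  "brick_point d a b = Complex ((real_of_int a + real_of_int b / 2) * d) (7 / 8 * real_of_int b * d)"

definition brick_lattice :: "real \<Rightarrow> real \<Rightarrow> complex set" where
  "brick_lattice d \<rho> = {brick_point d a b | a b. True} \<inter> cball 0 \<rho>"

lemma finite_brick_lattice:
  assumes "d > 0"
  shows "finite (brick_lattice d \<rho>)"
proof -
  \<comment> \<open>A crude index range: |b| is at most 8/7 and |a| at most 11/7 times
    \<open>\<rho> / d\<close>.\<close>
  define M where "M = \<lceil>2 * \<rho> / d\<rceil>"
  have "brick_lattice d \<rho> \<subseteq> (\<lambda>(a, b). brick_point d a b) ` ({-M..M} \<times> {-M..M})"
  proof
    fix p assume "p \<in> brick_lattice d \<rho>"
    then obtain a b where p: "p = brick_point d a b" "cmod p \<le> \<rho>" by (auto simp: brick_lattice_def)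
    have M: "2 * \<rho> \<le> of_int M * d"
      unfolding M_def using \<open>d > 0\<close> by (rule ceiling_divide_upper)
    have "\<bar>Re p\<bar> \<le> \<rho>" "\<bar>Im p\<bar> \<le> \<rho>" using p abs_Re_le_cmod[of p] abs_Im_le_cmod[of p] by auto
    then have *: "\<bar>(real_of_int a + real_of_int b / 2) * d\<bar> \<le> \<rho>" "\<bar>7 / 8 * real_of_int b * d\<bar> \<le> \<rho>"
      by (simp_all add: p brick_point_def)
    then have "\<bar>real_of_int b * d\<bar> \<le> 8 / 7 * \<rho>" "\<bar>real_of_int a * d\<bar> \<le> 11 / 7 * \<rho>" "\<rho> \<ge> 0"
      by (auto simp: algebra_simps abs_le_iff)
    then have "\<bar>real_of_int b\<bar> * d \<le> of_int M * d" "\<bar>real_of_int a\<bar> * d \<le> of_int M * d"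
      using M unfolding abs_mult abs_of_pos[OF \<open>d > 0\<close>] by linarith+
    then have "\<bar>b\<bar> \<le> M" "\<bar>a\<bar> \<le> M" using \<open>d > 0\<close> by simp_all
    then show "p \<in> (\<lambda>(a, b). brick_point d a b) ` ({-M..M} \<times> {-M..M})"
      using p by (auto intro!: image_eqI[where x = "(a, b)"])
  qed
  then show ?thesis by (rule finite_subset) auto
qed

text \<open>Since (7/8)^2 is at least 3/4, the squared distance is at least d^2 (u^2 + uv + v^2),
  and this positive definite integer form is at least 1 off the origin.\<close>

lemma brick_lattice_separated:
  assumes "d > 0" "x \<in> brick_lattice d \<rho>" "y \<in> brick_lattice d \<rho>" "x \<noteq> y"
  shows "d \<le> dist x y"
proof -
  obtain a b a' b' where xy: "x = brick_point d a b" "y = brick_point d a' b'"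
    using assms by (auto simp: brick_lattice_def)
  define u v where "u = a - a'" and "v = b - b'"
  have "u \<noteq> 0 \<or> v \<noteq> 0" using assms xy by (auto simp: u_def v_def)
  then have "4 * (u\<^sup>2 + u * v + v\<^sup>2) > 0"
  proof -
    have "4 * (u\<^sup>2 + u * v + v\<^sup>2) = (2 * u + v)\<^sup>2 + 3 * v\<^sup>2" by (simp add: power2_eq_square algebra_simps)
    moreover have "(2 * u + v)\<^sup>2 > 0 \<or> 3 * v\<^sup>2 > 0" using \<open>u \<noteq> 0 \<or> v \<noteq> 0\<close> by auto
    ultimately show ?thesis by (smt (verit) zero_le_power2)
  qed
  then have "1 \<le> u\<^sup>2 + u * v + v\<^sup>2" by simp
  then have "real_of_int 1 \<le> real_of_int (u\<^sup>2 + u * v + v\<^sup>2)" by (subst of_int_le_iff)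
  then have 1: "1 \<le> (real_of_int u)\<^sup>2 + real_of_int u * real_of_int v + (real_of_int v)\<^sup>2" by simp
  also have "\<dots> \<le> (real_of_int u + real_of_int v / 2)\<^sup>2 + (7 / 8 * real_of_int v)\<^sup>2"
    by (simp add: power2_eq_square algebra_simps)
  finally have "d\<^sup>2 * 1 \<le> d\<^sup>2 * ((real_of_int u + real_of_int v / 2)\<^sup>2 + (7 / 8 * real_of_int v)\<^sup>2)"
    by (intro mult_left_mono) auto
  also have "\<dots> = ((real_of_int u + real_of_int v / 2) * d)\<^sup>2 + (7 / 8 * real_of_int v * d)\<^sup>2"
    by (simp add: power2_eq_square algebra_simps)
  also have "\<dots> = (Re (x - y))\<^sup>2 + (Im (x - y))\<^sup>2"
    by (simp add: xy brick_point_def u_def v_def left_diff_distrib right_diff_distrib diff_divide_distrib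
        distrib_right algebra_simps)
  also have "\<dots> = (dist x y)\<^sup>2" by (simp add: dist_norm cmod_power2)
  finally have "d\<^sup>2 \<le> (dist x y)\<^sup>2" by simp
  then show ?thesis by (rule power2_le_imp_le) simp
qed

text \<open>Every point of the smaller disc lies in a brick whose corner is at distance at most d +
  7/8 d, so within \<open>2 * d\<close>. Hence the bricks of the lattice points cover that disc, and
  areas are compared.\<close>

lemma card_brick_lattice:
  assumes "d > 0" "2 * d \<le> \<rho>"
  shows "pi * (\<rho> - 2 * d)\<^sup>2 \<le> real (card (brick_lattice d \<rho>)) * (7 / 8 * d\<^sup>2)"
proof -
  define B where "B p = cbox p (p + Complex d (7 / 8 * d))" for p
  have cover: "cball 0 (\<rho> - 2 * d) \<subseteq> (\<Union>p\<in>brick_lattice d \<rho>. B p)"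
  proof
    fix w :: complex assume "w \<in> cball 0 (\<rho> - 2 * d)"
    then have w: "cmod w \<le> \<rho> - 2 * d" by simp
    \<comment> \<open>First the row is chosen, then the brick within the row, after undoing its
      half-step shift.\<close>
    define b where "b = \<lfloor>Im w / (7 / 8 * d)\<rfloor>"
    define a where "a = \<lfloor>Re w / d - real_of_int b / 2\<rfloor>"
    define p where "p = brick_point d a b"
    have "real_of_int b \<le> Im w / (7 / 8 * d)" "Im w / (7 / 8 * d) \<le> real_of_int b + 1"
      unfolding b_def by linarith+
    then have im: "Im p \<le> Im w" "Im w \<le> Im p + 7 / 8 * d"
      using \<open>d > 0\<close> by (auto simp: p_def brick_point_def field_simps)
    have "real_of_int a + real_of_int b / 2 \<le> Re w / d" "Re w / d \<le> real_of_int a + real_of_int b / 2 + 1"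
      unfolding a_def by linarith+
    then have re: "Re p \<le> Re w" "Re w \<le> Re p + d"
      using \<open>d > 0\<close> by (auto simp: p_def brick_point_def field_simps)
    have "cmod (p - w) \<le> \<bar>Re (p - w)\<bar> + \<bar>Im (p - w)\<bar>" by (rule cmod_le)
    also have "\<dots> \<le> 2 * d" using im re \<open>d > 0\<close> by simp
    finally have "cmod p \<le> \<rho>" using w norm_triangle_sub[of p w] by linarith
    then have "p \<in> brick_lattice d \<rho>" unfolding brick_lattice_def p_def by auto
    moreover have "w \<in> B p" using im re by (simp add: B_def in_cbox_complex_iff)
    ultimately show "w \<in> (\<Union>p\<in>brick_lattice d \<rho>. B p)" by blast
  qed
  have "pi * (\<rho> - 2 * d)\<^sup>2 = measure lborel (cball (0::complex) (\<rho> - 2 * d))"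
    using assms content_cball[of "\<rho> - 2 * d" "0::complex"] by (simp add: unit_ball_vol_2)
  also have "\<dots> \<le> measure lborel (\<Union>p\<in>brick_lattice d \<rho>. B p)"
    using cover finite_brick_lattice[OF \<open>d > 0\<close>, of \<rho>]
    by (intro measure_mono_fmeasurable) (auto simp: B_def intro!: fmeasurable_compact compact_UN)
  also have "\<dots> \<le> (\<Sum>p\<in>brick_lattice d \<rho>. measure lborel (B p))"
    using finite_brick_lattice[OF \<open>d > 0\<close>] by (intro measure_UNION_le) (auto simp: B_def)
  also have "\<dots> = (\<Sum>p\<in>brick_lattice d \<rho>. 7 / 8 * d\<^sup>2)"
  proof (intro sum.cong refl)
    fix p
    show "measure lborel (B p) = 7 / 8 * d\<^sup>2"
      unfolding B_def using \<open>d > 0\<close>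
      by (subst measure_lborel_cbox_eq) (auto simp: Basis_complex_def power2_eq_square)
  qed
  finally show ?thesis by simp
qed

section \<open>Nested polygons along a spiral\<close>

text \<open>After \<open>k\<close> peelings all \<open>S j\<close> with \<open>k \<le> j\<close> are
  intact. In the next one, a point of a later \<open>S j\<close> lies in the hull of
  \<open>S k\<close>; if it were extreme in the larger hull, it would be extreme there too and so
  belong to \<open>S k\<close>, against disjointness. The remaining points of \<open>X\<close> are
  arbitrary.\<close>

lemma layer_number_chain:
  fixes X :: "'a::euclidean_space set"
  assumes fin: "finite X" and sub: "\<And>i. i < L \<Longrightarrow> S i \<subseteq> X" and ne: "\<And>i. i < L \<Longrightarrow> S i \<noteq> {}"
    and hull: "\<And>i. Suc i < L \<Longrightarrow> S (Suc i) \<subseteq> convex hull (S i)"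
    and disj: "\<And>i j. i < j \<Longrightarrow> j < L \<Longrightarrow> S i \<inter> S j = {}"
  shows "L \<le> layer_number X"
proof -
  have nested: "S j \<subseteq> convex hull (S i)" if "i \<le> j" "j < L" for i j
    using that
  proof (induction j rule: dec_induct)
    case base
    then show ?case by (simp add: hull_subset)
  next
    case (step j)
    then have "convex hull (S j) \<subseteq> convex hull (S i)"
      by (intro hull_minimal) auto
    then show ?case using hull[of j] step by auto
  qed
  have survive: "k \<le> j \<Longrightarrow> j < L \<Longrightarrow> S j \<subseteq> peeling X (Suc k)" for k j
  proof (induction k arbitrary: j)
    case 0
    then show ?case using sub by (simp add: peeling_1[simplified])
  next
    case (Suc k)
    let ?P = "peeling X (Suc k)"
    have P: "S j \<subseteq> ?P" "S k \<subseteq> ?P" using Suc by auto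
    have "x \<notin> extreme_points ?P" if x: "x \<in> S j" for x
    proof
      assume "x \<in> extreme_points ?P"
      then have "x extreme_point_of (convex hull ?P)" by (simp add: extreme_points_def)
      moreover have "x \<in> convex hull (S k)" using nested[of k j] Suc x by auto
      moreover have "convex hull (S k) \<subseteq> convex hull ?P" using P(2) by (rule hull_mono)
      ultimately have "x extreme_point_of (convex hull (S k))"
        unfolding extreme_point_of_def by blast
      then have "x \<in> S k" by (rule extreme_point_of_convex_hull)
      then show False using disj[of k j] Suc x by auto
    qed
    then show ?case using P(1) by (auto simp: peeling_Suc')
  qed
  show ?thesis
  proof (rule ccontr)
    assume "\<not> L \<le> layer_number X"
    then have k: "layer_number X < L" by simp
    have "peeling X (Suc (layer_number X)) = {}" using peeling_layer_number[OF fin] by simp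
    then show False using survive[OF le_refl k] ne[OF k] by blast
  qed
qed

section \<open>Chord lengths on the unit circle\<close>

lemma norm_cis_minus_1_power2: "(cmod (cis t - 1))\<^sup>2 = 2 - 2 * cos t"
  by (simp add: cmod_power2 power2_diff)

lemma norm_cis_minus_1: "cmod (cis t - 1) = 2 * \<bar>sin (t / 2)\<bar>"
proof -
  have "(cmod (cis t - 1))\<^sup>2 = (2 * \<bar>sin (t / 2)\<bar>)\<^sup>2"
    using cos_double_sin[of "t / 2"] by (simp add: norm_cis_minus_1_power2 power_mult_distrib)
  then show ?thesis by (rule power2_eq_imp_eq) auto
qed

text \<open>The chord is 2 sin(pi q / m), symmetric under replacing q by m - q, so q is at most m /
  2 without loss of generality and Jordan's inequality applies.\<close>

lemma norm_cis_root_minus_1_ge: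
  assumes "0 < q" "q < m"
  shows "4 / real m \<le> cmod (cis (2 * pi * real q / real m) - 1)"
proof -
  have m: "real m > 0" using assms by simp
  have half: "2 / real m \<le> sin (pi * real r / real m)" if "0 < r" "2 * r \<le> m" for r
  proof -
    have "2 / real m \<le> 2 * (pi * real r / real m) / pi" using that m by (simp add: field_simps)
    also have "\<dots> \<le> sin (pi * real r / real m)"
    proof (rule sin_ge_Jordan)
      have "2 * real r \<le> real m" using that(2) by linarith
      then show "pi * real r / real m \<le> pi / 2" using m by (simp add: field_simps)
    qed simp
    finally show ?thesis .
  qed
  have "2 / real m \<le> sin (pi * real q / real m)"
  proof (cases "2 * q \<le> m")
    case True
    then show ?thesis using half assms by simp
  next
    case False
    have "pi * real (m - q) / real m = pi - pi * real q / real m"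
      using assms m by (simp add: of_nat_diff field_simps)
    then have "sin (pi * real (m - q) / real m) = sin (pi * real q / real m)" by simp
    then show ?thesis using half[of "m - q"] False assms by simp
  qed
  then show ?thesis by (simp add: norm_cis_minus_1)
qed

section \<open>Shrinking and separation of the rotated polygons\<close>

locale spiral =
  fixes m :: nat
  assumes m_ge: "m \<ge> 100"
begin

definition \<omega> :: complex where "\<omega> = cis (2 * pi / real m)"
definition \<zeta> :: complex where "\<zeta> = of_real (1 - 1 / real m) + of_real (1 / real m) * \<omega>"
definition polygon :: "nat \<Rightarrow> complex set" where "polygon i = range (\<lambda>k. \<zeta> ^ i * \<omega> ^ k)"

lemma m_pos: "real m > 0" using m_ge by simp

lemma norm_\<omega> [simp]: "cmod \<omega> = 1" by (simp add: \<omega>_def)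

lemma \<omega>_power: "\<omega> ^ k = cis (2 * pi * real k / real m)"
  by (simp add: \<omega>_def Complex.DeMoivre mult_ac)

lemma \<omega>_power_m [simp]: "\<omega> ^ m = 1"
  using m_pos by (simp add: \<omega>_power)

lemma \<omega>_power_mod: "\<omega> ^ (k mod m) = \<omega> ^ k"
proof -
  have "\<omega> ^ k = \<omega> ^ (m * (k div m) + k mod m)" by simp
  then show ?thesis unfolding power_add power_mult by simp
qed

lemma norm_\<omega>_minus_1: "4 / real m \<le> cmod (\<omega> - 1)" "cmod (\<omega> - 1) \<le> 6.3 / real m"
proof -
  show "4 / real m \<le> cmod (\<omega> - 1)"
    using norm_cis_root_minus_1_ge[of 1 m] m_ge by (simp add: \<omega>_def)
  have "cmod (\<omega> - 1) \<le> 2 * \<bar>pi / real m\<bar>"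
    unfolding \<omega>_def norm_cis_minus_1 using abs_sin_x_le_abs_x[of "pi / real m"] by simp
  also have "\<dots> = (2 * pi) / real m" by simp
  also have "\<dots> \<le> 6.3 / real m" using pi_approx by (intro divide_right_mono) auto
  finally show "cmod (\<omega> - 1) \<le> 6.3 / real m" .
qed

lemma \<zeta>_minus_1: "\<zeta> - 1 = of_real (1 / real m) * (\<omega> - 1)"
  by (simp add: \<zeta>_def diff_divide_distrib algebra_simps)

text \<open>The point at parameter s on the chord from 1 to \<omega> has squared norm 1 - s(1 -
  s)|\<omega> - 1|^2. With s = 1/m and a chord of order 1/m the loss per polygon is of order m^(-3),
  so order m^3 polygons fit into a fixed annulus.\<close>

lemma norm_\<zeta>_power2: "(cmod \<zeta>)\<^sup>2 = 1 - (1 / real m) * (1 - 1 / real m) * (cmod (\<omega> - 1))\<^sup>2"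
proof -
  define s where "s = 1 / real m"
  define t where "t = 2 * pi / real m"
  have "(cmod \<zeta>)\<^sup>2 = (1 - s + s * cos t)\<^sup>2 + (s * sin t)\<^sup>2"
    by (simp add: \<zeta>_def \<omega>_def cmod_power2 s_def t_def)
  also have "\<dots> = (1 - s)\<^sup>2 + 2 * (1 - s) * s * cos t + s\<^sup>2 * ((sin t)\<^sup>2 + (cos t)\<^sup>2)"
    by algebra
  also have "\<dots> = 1 - s * (1 - s) * (2 - 2 * cos t)" by (simp add: power2_eq_square algebra_simps)
  finally show ?thesis by (simp add: s_def t_def \<omega>_def norm_cis_minus_1_power2)
qed

lemma norm_\<zeta>_power2_bounds: "1 - 40 / real m ^ 3 \<le> (cmod \<zeta>)\<^sup>2" "(cmod \<zeta>)\<^sup>2 \<le> 1 - 8 / real m ^ 3"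
proof -
  have "(cmod (\<omega> - 1))\<^sup>2 \<le> (6.3 / real m)\<^sup>2" by (intro power_mono norm_\<omega>_minus_1) simp
  then have "(1 / real m) * (1 - 1 / real m) * (cmod (\<omega> - 1))\<^sup>2 \<le> (1 / real m) * 1 * (6.3 / real m)\<^sup>2"
    using m_pos by (intro mult_mono) (auto simp: field_simps)
  also have "\<dots> \<le> 40 / real m ^ 3" using m_pos by (simp add: power2_eq_square power3_eq_cube field_simps)
  finally show "1 - 40 / real m ^ 3 \<le> (cmod \<zeta>)\<^sup>2" by (simp add: norm_\<zeta>_power2)
  have "8 / real m ^ 3 = (1 / real m) * (1 / 2) * (4 / real m)\<^sup>2"
    by (simp add: power2_eq_square power3_eq_cube)
  also have "\<dots> \<le> (1 / real m) * (1 - 1 / real m) * (cmod (\<omega> - 1))\<^sup>2"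
    using m_ge norm_\<omega>_minus_1 by (intro mult_mono power_mono) (auto simp: field_simps)
  finally show "(cmod \<zeta>)\<^sup>2 \<le> 1 - 8 / real m ^ 3" by (simp add: norm_\<zeta>_power2)
qed

lemma norm_\<zeta>: "0 < cmod \<zeta>" "cmod \<zeta> < 1"
proof -
  have "real m ^ 3 \<ge> 100 ^ 3" using m_ge by (intro power_mono) auto
  then have "40 / real m ^ 3 < 1" "8 / real m ^ 3 > 0" using m_pos by (auto simp: field_simps)
  then have "0 < (cmod \<zeta>)\<^sup>2" "(cmod \<zeta>)\<^sup>2 < 1" using norm_\<zeta>_power2_bounds by linarith+
  then show "0 < cmod \<zeta>" "cmod \<zeta> < 1" by (auto simp: power2_less_1_iff abs_square_less_1)
qed

text \<open>By Bernoulli, \<open>i\<close> steps lower the squared norm by at most 40 i / m^3, so by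
  at most 1/100; a norm below 1 exceeds its square.\<close>

lemma norm_\<zeta>_power_ge:
  assumes "4000 * i \<le> m ^ 3"
  shows "0.99 \<le> cmod (\<zeta> ^ i)"
proof -
  have m3: "real m ^ 3 \<ge> 100 ^ 3" using m_ge by (intro power_mono) auto
  have "real (4000 * i) \<le> real (m ^ 3)" using assms by (subst of_nat_le_iff)
  then have i: "4000 * real i \<le> real m ^ 3" by simp
  have "0.99 \<le> 1 + real i * (- 40 / real m ^ 3)" using i m3 m_pos by (simp add: field_simps)
  also have "\<dots> \<le> (1 + (- 40 / real m ^ 3)) ^ i"
    using m3 m_pos by (intro Bernoulli_inequality) (simp add: field_simps)
  also have "\<dots> \<le> ((cmod \<zeta>)\<^sup>2) ^ i"
    using norm_\<zeta>_power2_bounds m3 m_pos by (intro power_mono) (auto simp: field_simps)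
  also have "\<dots> = (cmod (\<zeta> ^ i))\<^sup>2" by (simp add: norm_power mult.commute flip: power_mult)
  also have "\<dots> \<le> cmod (\<zeta> ^ i)"
    using norm_\<zeta> by (simp add: power2_eq_square norm_power mult_left_le power_le_one)
  finally show ?thesis .
qed

lemma polygon_finite: "finite (polygon i)"
proof -
  have "polygon i \<subseteq> (\<lambda>k. \<zeta> ^ i * \<omega> ^ k) ` {..<m}"
  proof
    fix x assume "x \<in> polygon i"
    then obtain k where "x = \<zeta> ^ i * \<omega> ^ k" by (auto simp: polygon_def)
    then show "x \<in> (\<lambda>k. \<zeta> ^ i * \<omega> ^ k) ` {..<m}"
      using m_ge by (intro image_eqI[where x = "k mod m"]) (auto simp: \<omega>_power_mod)
  qed
  then show ?thesis by (rule finite_subset) auto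
qed

lemma polygon_norm: "x \<in> polygon i \<Longrightarrow> cmod x = cmod \<zeta> ^ i"
  by (auto simp: polygon_def norm_mult norm_power)

lemma polygon_disjoint:
  assumes "i < j"
  shows "polygon i \<inter> polygon j = {}"
proof -
  have "cmod \<zeta> ^ j < cmod \<zeta> ^ i" using assms norm_\<zeta> by (intro power_strict_decreasing)
  then show ?thesis using polygon_norm[of _ i] polygon_norm[of _ j] by force
qed

lemma polygon_Suc_subset_hull: "polygon (Suc i) \<subseteq> convex hull (polygon i)"
proof
  fix x assume "x \<in> polygon (Suc i)"
  then obtain k where k: "x = \<zeta> ^ Suc i * \<omega> ^ k" by (auto simp: polygon_def)
  have "x = (1 - 1 / real m) *\<^sub>R (\<zeta> ^ i * \<omega> ^ k) + (1 / real m) *\<^sub>R (\<zeta> ^ i * \<omega> ^ Suc k)"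
    unfolding k power_Suc by (subst (1) \<zeta>_def) (simp add: scaleR_conv_of_real algebra_simps)
  also have "\<dots> \<in> convex hull (polygon i)"
  proof (intro convexD convex_convex_hull hull_inc)
    show "\<zeta> ^ i * \<omega> ^ k \<in> polygon i" "\<zeta> ^ i * \<omega> ^ Suc k \<in> polygon i"
      unfolding polygon_def by (rule rangeI)+
  qed (use m_ge in auto)
  finally show "x \<in> convex hull (polygon i)" .
qed

text \<open>Quotients of spiral points have this form. For p at least m/10 the norm alone has
  dropped by order m^(-2). For smaller p, \<zeta>^p is within 0.63/m of 1: either \<omega>^q is at
  least 4/m away from 1 and dominates, or it equals 1 and the geometric sum for \<zeta>^p - 1
  decides.\<close>

lemma spiral_gap:
  assumes "\<zeta> ^ p * \<omega> ^ q \<noteq> 1"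
  shows "1 / (5 * (real m)\<^sup>2) \<le> cmod (\<zeta> ^ p * \<omega> ^ q - 1)"
proof (cases "10 * p < m")
  case False
  have "cmod \<zeta> ^ p \<le> 1 - 1 / (5 * (real m)\<^sup>2)"
  proof -
    define y where "y = 1 / (5 * (real m)\<^sup>2)"
    have "(real m)\<^sup>2 \<ge> 100\<^sup>2" using m_ge by (intro power_mono) auto
    then have y: "0 < y" "y < 1/10" using m_pos by (auto simp: y_def field_simps)
    have "(cmod \<zeta> ^ p)\<^sup>2 = ((cmod \<zeta>)\<^sup>2) ^ p" by (simp add: mult.commute flip: power_mult)
    also have "\<dots> \<le> (1 + (- 8 / real m ^ 3)) ^ p"
      using norm_\<zeta>_power2_bounds by (intro power_mono) auto
    also have "\<dots> \<le> exp (- 8 / real m ^ 3) ^ p"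
    proof (intro power_mono exp_ge_add_one_self)
      have "real m ^ 3 \<ge> 100 ^ 3" using m_ge by (intro power_mono) auto
      then show "0 \<le> 1 + - 8 / real m ^ 3" using m_pos by (simp add: field_simps)
    qed
    also have "\<dots> = exp (- (8 * real p / real m ^ 3))" by (subst exp_of_nat_mult[symmetric]) (simp add: mult.commute)
    also have "\<dots> \<le> exp (- (4 * y))"
    proof -
      have "4 * y * real m ^ 3 = 0.8 * real m"
        using m_pos by (simp add: y_def power2_eq_square power3_eq_cube)
      also have "\<dots> \<le> 8 * real p" using False by linarith
      finally have "4 * y \<le> 8 * real p / real m ^ 3" using m_pos by (simp add: field_simps)
      then show ?thesis by simp
    qed
    also have "\<dots> \<le> 1 / (1 + 4 * y)"
      unfolding exp_minus inverse_eq_divide using y exp_ge_add_one_self[of "4 * y"]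
      by (intro divide_left_mono) (auto simp del: exp_ge_add_one_self)
    also have "\<dots> \<le> (1 - y)\<^sup>2"
    proof -
      \<comment> \<open>The linear term 2y dominates because y is below 1/10.\<close>
      have "0 \<le> y * (2 - 7 * y + 4 * y\<^sup>2)"
        using y zero_le_power2[of y] by (intro mult_nonneg_nonneg) linarith+
      also have "\<dots> = (1 - y)\<^sup>2 * (1 + 4 * y) - 1"
        by (simp add: power2_eq_square algebra_simps)
      finally have "1 \<le> (1 - y)\<^sup>2 * (1 + 4 * y)" by simp
      then show ?thesis using y by (subst pos_divide_le_eq) auto
    qed
    finally show ?thesis using y by (simp add: power_mono_iff flip: y_def)
  qed
  then show ?thesis
    using norm_triangle_ineq3[of "\<zeta> ^ p * \<omega> ^ q" 1] by (simp add: norm_mult norm_power)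
next
  case True
  define h where "h = cmod (\<zeta> - 1)"
  have h: "4 / (real m)\<^sup>2 \<le> h" "h \<le> 6.3 / (real m)\<^sup>2"
    using norm_\<omega>_minus_1 m_pos
    by (auto simp: h_def \<zeta>_minus_1 norm_mult norm_divide power2_eq_square field_simps)
  have lip: "cmod (\<zeta> ^ i - 1) \<le> real i * h" for i
    using norm_power_diff[of \<zeta> 1 i] norm_\<zeta> by (simp add: h_def)
  have ph: "real p * h \<le> 0.63 / real m"
  proof -
    have "real p * h \<le> (real m / 10) * (6.3 / (real m)\<^sup>2)"
      using True h by (intro mult_mono) (auto simp: h_def)
    also have "\<dots> = 0.63 / real m" using m_pos by (simp add: power2_eq_square)
    finally show ?thesis .
  qed
  show ?thesis
  proof (cases "q mod m = 0")
    case True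
    then have "\<omega> ^ q = 1" using \<omega>_power_mod[of q] by simp
    then have "p \<noteq> 0" using assms by (cases p) auto
    \<comment> \<open>All summands are within 1/2 of 1, so the geometric sum has modulus at least
      p/2.\<close>
    have "cmod ((\<Sum>i<p. \<zeta> ^ i) - of_nat p) = cmod (\<Sum>i<p. \<zeta> ^ i - 1)" by (simp add: sum_subtractf)
    also have "\<dots> \<le> (\<Sum>i<p. real p * h)"
    proof (intro sum_norm_le order_trans[OF lip] mult_right_mono)
    qed (auto simp: h_def)
    also have "\<dots> \<le> real p * (1 / 2)"
    proof -
      have "0.63 / real m \<le> 1 / 2" using m_ge m_pos by (simp add: field_simps)
      then have "real p * h \<le> 1 / 2" using ph by linarith
      then have "real p * (real p * h) \<le> real p * (1 / 2)" by (rule mult_left_mono) simp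
      then show ?thesis by simp
    qed
    finally have "real p / 2 \<le> cmod (\<Sum>i<p. \<zeta> ^ i)"
      using norm_triangle_ineq3[of "\<Sum>i<p. \<zeta> ^ i" "of_nat p"] by simp
    then have "1 / 2 \<le> cmod (\<Sum>i<p. \<zeta> ^ i)" using \<open>p \<noteq> 0\<close> by linarith
    then have "h * (1 / 2) \<le> h * cmod (\<Sum>i<p. \<zeta> ^ i)" by (intro mult_left_mono) (auto simp: h_def)
    also have "\<dots> = cmod (\<zeta> ^ p - 1)"
      unfolding h_def power_diff_1_eq by (simp add: norm_mult)
    finally have "h / 2 \<le> cmod (\<zeta> ^ p - 1)" by simp
    moreover have "1 / (5 * (real m)\<^sup>2) \<le> h / 2"
      using h(1) m_pos by (simp add: field_simps)
    ultimately show ?thesis using \<open>\<omega> ^ q = 1\<close> by simp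
  next
    case False
    have "4 / real m \<le> cmod (\<omega> ^ (q mod m) - 1)"
      unfolding \<omega>_power using False m_ge by (intro norm_cis_root_minus_1_ge) auto
    then have "4 / real m \<le> cmod (\<omega> ^ q - 1)" by (simp add: \<omega>_power_mod)
    also have "\<omega> ^ q - 1 = (\<zeta> ^ p * \<omega> ^ q - 1) - (\<zeta> ^ p - 1) * \<omega> ^ q" by (simp add: algebra_simps)
    also have "cmod \<dots> \<le> cmod (\<zeta> ^ p * \<omega> ^ q - 1) + cmod (\<zeta> ^ p - 1)"
      by (rule order_trans[OF norm_triangle_ineq4]) (simp add: norm_mult norm_power)
    also have "\<dots> \<le> cmod (\<zeta> ^ p * \<omega> ^ q - 1) + 0.63 / real m" using lip[of p] ph by simp
    finally have "3 / real m \<le> cmod (\<zeta> ^ p * \<omega> ^ q - 1)" using m_pos by (simp add: field_simps)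
    moreover have "1 / (5 * (real m)\<^sup>2) \<le> 3 / real m"
      using m_ge by (simp add: power2_eq_square field_simps)
    ultimately show ?thesis by simp
  qed
qed

text \<open>Dividing by the point on the outer polygon, of modulus at least 0.99, reduces the claim
  to \<open>spiral_gap\<close>.\<close>

lemma polygon_separated:
  assumes x: "x \<in> polygon i" "4000 * i \<le> m ^ 3" and y: "y \<in> polygon j" "4000 * j \<le> m ^ 3"
    and "x \<noteq> y"
  shows "1 / (10 * (real m)\<^sup>2) \<le> dist x y"
proof -
  have *: "1 / (10 * (real m)\<^sup>2) \<le> dist x y"
    if "i \<le> j" "x \<in> polygon i" "y \<in> polygon j" "4000 * i \<le> m ^ 3" "x \<noteq> y" for i j x y
  proof -
    obtain k l where kl: "x = \<zeta> ^ i * \<omega> ^ k" "y = \<zeta> ^ j * \<omega> ^ l"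
      using \<open>x \<in> polygon i\<close> \<open>y \<in> polygon j\<close> by (auto simp: polygon_def)
    \<comment> \<open>A natural number congruent to l - k modulo m.\<close>
    define q where "q = l + (m - 1) * k"
    have "k + q = l + m * k" using m_ge by (cases m) (auto simp: q_def)
    then have "\<omega> ^ k * \<omega> ^ q = \<omega> ^ (l + m * k)" by (simp flip: power_add)
    also have "\<dots> = \<omega> ^ l" by (simp add: power_add power_mult)
    finally have q: "\<omega> ^ k * \<omega> ^ q = \<omega> ^ l" .
    have "y = \<zeta> ^ i * \<zeta> ^ (j - i) * (\<omega> ^ k * \<omega> ^ q)"
      unfolding q kl using \<open>i \<le> j\<close> by (simp flip: power_add)
    then have y: "y = x * (\<zeta> ^ (j - i) * \<omega> ^ q)" by (simp add: kl mult_ac)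
    then have ne: "\<zeta> ^ (j - i) * \<omega> ^ q \<noteq> 1" using \<open>x \<noteq> y\<close> by auto
    have "cmod x = cmod (\<zeta> ^ i)" by (simp add: kl norm_mult norm_power)
    then have nx: "0.99 \<le> cmod x" using norm_\<zeta>_power_ge[OF \<open>4000 * i \<le> m ^ 3\<close>] by simp
    have "1 / (10 * (real m)\<^sup>2) \<le> 0.99 * (1 / (5 * (real m)\<^sup>2))" using m_pos by (simp add: field_simps)
    also have "\<dots> \<le> cmod x * cmod (\<zeta> ^ (j - i) * \<omega> ^ q - 1)"
      using nx spiral_gap[OF ne] by (intro mult_mono) auto
    also have "\<dots> = dist x y"
      unfolding dist_norm norm_minus_commute[of x y] by (simp add: y algebra_simps flip: norm_mult)
    finally show ?thesis .
  qed
  show ?thesis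
  proof (cases "i \<le> j")
    case True
    then show ?thesis using * assms by blast
  next
    case False
    then show ?thesis using *[of j i y x] assms by (auto simp: dist_commute)
  qed
qed

end

section \<open>Transfer to the real plane and assembly of the lower bound example\<close>

definition vec_of_complex :: "complex \<Rightarrow> real ^ 2" where
  "vec_of_complex w = vector [Re w, Im w]"

lemma linear_vec_of_complex: "linear vec_of_complex"
  by (rule linearI) (simp_all add: vec_of_complex_def vec_eq_iff forall_2)

lemma dist_vec_of_complex [simp]: "dist (vec_of_complex x) (vec_of_complex y) = dist x y"
  by (simp add: vec_of_complex_def dist_norm norm_vec_def L2_set_def sum_2 cmod_def)

lemma inj_vec_of_complex: "inj vec_of_complex"
  by (rule injI) (metis dist_eq_0_iff dist_vec_of_complex)

lemma layer_number_lower_bound_construction: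
  fixes k :: nat
  assumes "k \<ge> 5" and "\<alpha> \<ge> 1"
  shows "\<exists>X :: (real ^ 2) set. evenly_distributed \<alpha> X \<and> k \<le> card X \<and> 2 * k ^ 3 \<le> layer_number X
    \<and> real (card X) \<le> 441 * real (20 * k) ^ 4"
proof -
  \<comment> \<open>The factor 20 makes m^3 / 4000 equal to the integer \<open>2 * k ^ 3\<close>,
    the number of polygons used.\<close>
  define m where "m = 20 * k"
  interpret spiral m by unfold_locales (use assms in \<open>simp add: m_def\<close>)
  define L where "L = 2 * k ^ 3"
  define d where "d = 1 / (10 * (real m)\<^sup>2)"
  have "(real m)\<^sup>2 \<ge> 100\<^sup>2" using m_ge by (intro power_mono) auto
  then have d: "0 < d" "d \<le> 1 / 10 ^ 5" using m_pos by (auto simp: d_def field_simps)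
  have L: "4000 * i \<le> m ^ 3" if "i < L" for i
    using that by (simp add: L_def m_def power_mult_distrib)
  \<comment> \<open>The gap of 0.005 to the annulus far exceeds \<open>d\<close>, yet the disc is
    large enough for the density 3.4.\<close>
  define H where "H = brick_lattice d 0.985"
  define Y where "Y = (\<Union>i<L. polygon i)"
  define X where "X = Y \<union> H"
  have finX: "finite X"
    unfolding X_def Y_def H_def using polygon_finite finite_brick_lattice d by auto
  have normY: "0.99 \<le> cmod y" "cmod y \<le> 1" if y: "y \<in> Y" for y
  proof -
    obtain i where "i < L" "y \<in> polygon i" using y by (auto simp: Y_def)
    then have "i < L" "cmod y = cmod (\<zeta> ^ i)" using polygon_norm by (auto simp: norm_power)
    then show "0.99 \<le> cmod y" "cmod y \<le> 1"
      using norm_\<zeta>_power_ge[OF L] norm_\<zeta> by (auto simp: norm_power power_le_one)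
  qed
  have normH: "cmod y \<le> 0.985" if "y \<in> H" for y
    using that by (simp add: H_def brick_lattice_def)
  have YH: "d \<le> dist x y" if "x \<in> Y" "y \<in> H" for x y
    using normY(1)[OF that(1)] normH[OF that(2)] norm_triangle_ineq2[of x y] d by (simp add: dist_norm)
  have sep: "d \<le> dist x y" if xy: "x \<in> X" "y \<in> X" "x \<noteq> y" for x y
  proof -
    consider "x \<in> Y" "y \<in> Y" | "x \<in> Y" "y \<in> H" | "x \<in> H" "y \<in> Y" | "x \<in> H" "y \<in> H"
      using xy by (auto simp: X_def)
    then show ?thesis
    proof cases
      case 1
      then obtain i j where "i < L" "x \<in> polygon i" "j < L" "y \<in> polygon j" by (auto simp: Y_def)
      then show ?thesis unfolding d_def using polygon_separated L \<open>x \<noteq> y\<close> by blast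
    next
      case 4
      then show ?thesis unfolding H_def using brick_lattice_separated d(1) \<open>x \<noteq> y\<close> by blast
    next
      case 3
      then show ?thesis using YH[of y x] by (simp add: dist_commute)
    qed (use YH in simp)
  qed
  have norm1: "cmod x \<le> 1" if "x \<in> X" for x
    using that normY(2)[of x] normH[of x] by (auto simp: X_def)
  have dense: "34 / 10 \<le> real (card X) * d\<^sup>2"
  proof -
    \<comment> \<open>The margin is small: 2.975 against about 3.016.\<close>
    have "3.4 * (7 / 8) \<le> 3.14 * (0.98\<^sup>2 :: real)" by (simp add: power2_eq_square)
    also have "\<dots> \<le> pi * (0.985 - 2 * d)\<^sup>2"
    proof (intro mult_mono power_mono)
      show "3.14 \<le> pi" using pi_approx(1) by simp
      show "0.98 \<le> 0.985 - 2 * d" using d by simp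
    qed auto
    also have "\<dots> \<le> real (card H) * (7 / 8 * d\<^sup>2)"
      unfolding H_def using d by (intro card_brick_lattice) auto
    also have "\<dots> \<le> real (card X) * (7 / 8 * d\<^sup>2)"
      using finX by (intro mult_right_mono of_nat_mono card_mono) (auto simp: X_def)
    finally show ?thesis by simp
  qed
  define Z where "Z = vec_of_complex ` X"
  have cardZ: "card Z = card X"
    unfolding Z_def by (intro card_image inj_on_subset[OF inj_vec_of_complex]) simp
  have ev: "evenly_distributed \<alpha> Z"
  proof (rule evenly_distributed_of_separated)
    show "Z \<subseteq> cball (vec_of_complex 0) 1"
      unfolding Z_def using norm1 by (intro image_subsetI) (simp add: mem_cball)
    show "d \<le> dist u v" if uv: "u \<in> Z" "v \<in> Z" "u \<noteq> v" for u v
    proof -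
      obtain x y where "x \<in> X" "y \<in> X" "u = vec_of_complex x" "v = vec_of_complex y"
        using uv unfolding Z_def by blast
      then show ?thesis using sep[of x y] \<open>u \<noteq> v\<close> by auto
    qed
    show "34 / 10 \<le> real (card Z) * d\<^sup>2" unfolding cardZ by (rule dense)
    show "finite Z" unfolding Z_def using finX by (rule finite_imageI)
  qed (use d \<open>\<alpha> \<ge> 1\<close> in simp_all)
  have "L \<le> layer_number Z"
  proof (rule layer_number_chain[where S = "\<lambda>i. vec_of_complex ` polygon i"])
    show "vec_of_complex ` polygon (Suc i) \<subseteq> convex hull (vec_of_complex ` polygon i)" for i
      using polygon_Suc_subset_hull[of i] convex_hull_linear_image[OF linear_vec_of_complex, of "polygon i"]
      by blast
    show "vec_of_complex ` polygon i \<inter> vec_of_complex ` polygon j = {}" if "i < j" for i j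
      using polygon_disjoint[OF that] inj_vec_of_complex by (simp flip: image_Int)
  qed (use finX in \<open>auto simp: Z_def X_def Y_def polygon_def\<close>)
  moreover have "k \<le> card Z"
  proof -
    have d2: "d\<^sup>2 = 1 / (100 * real m ^ 4)" by (simp add: d_def power_divide power_mult_distrib flip: power_mult)
    have "real k \<le> real m" by (simp add: m_def)
    also have "\<dots> \<le> real m ^ 4" using m_ge by (intro self_le_power) auto
    also have "\<dots> \<le> 340 * real m ^ 4" by simp
    also have "\<dots> \<le> real (card X)"
      using dense m_pos by (simp add: d2 field_simps)
    finally show ?thesis by (simp add: cardZ)
  qed
  moreover have "real (card Z) \<le> 441 * real m ^ 4"
  proof -
    \<comment> \<open>Packing in the unit disc bounds the cardinality by order d^(-2), that is m^4,
      against order m^3 layers.\<close>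
    have "real (card X) * d\<^sup>2 \<le> (2 + d)\<^sup>2"
      using card_separated_packing[OF finX, of 0 1 d] sep norm1 d by force
    then have "real (card X) \<le> ((2 + d) / d)\<^sup>2" using d by (simp add: power_divide field_simps)
    also have "(2 + d) / d = 20 * (real m)\<^sup>2 + 1" using m_pos by (simp add: d_def field_simps)
    also have "\<dots>\<^sup>2 \<le> (21 * (real m)\<^sup>2)\<^sup>2"
      using \<open>(real m)\<^sup>2 \<ge> 100\<^sup>2\<close> by (intro power_mono) auto
    also have "\<dots> = 441 * real m ^ 4" by (simp add: power_mult_distrib flip: power_mult)
    finally show ?thesis by (simp add: cardZ)
  qed
  ultimately show ?thesis using ev unfolding L_def m_def by blast
qed

theorem theorem1p3:
  fixes \<alpha> :: real
  assumes "\<alpha> > 1"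
  shows "(\<exists>A>0. \<forall>X :: (real ^ 2) set. evenly_distributed \<alpha> X \<longrightarrow>
            real (layer_number X) \<le> A * real (card X) powr (3/4)) \<and>
         (\<exists>c>0. \<forall>N :: nat. \<exists>X :: (real ^ 2) set. evenly_distributed \<alpha> X \<and> card X \<ge> N \<and>
            real (layer_number X) \<ge> c * real (card X) powr (3/4))"
proof (intro conjI)
  show "\<exists>A>0. \<forall>X :: (real ^ 2) set. evenly_distributed \<alpha> X \<longrightarrow>
      real (layer_number X) \<le> A * real (card X) powr (3/4)"
    using layer_number_upper_bound assms
    by (intro exI[of _ "2 + 10 * sqrt (\<alpha> * pi)"]) (auto intro: add_pos_nonneg)
  \<comment> \<open>From 441^(3/4) at most 441 and (20k)^3 = 4000 * 2k^3.\<close>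
  define c where "c = 1 / (441 * 4000 :: real)"
  have "\<exists>X :: (real ^ 2) set. evenly_distributed \<alpha> X \<and> card X \<ge> N \<and>
      real (layer_number X) \<ge> c * real (card X) powr (3/4)" for N
  proof -
    \<comment> \<open>Ensures both \<open>k \<ge> 5\<close> and a cardinality of at least
      \<open>N\<close>.\<close>
    define k where "k = N + 5"
    obtain X :: "(real ^ 2) set" where X: "evenly_distributed \<alpha> X" "k \<le> card X"
      "2 * k ^ 3 \<le> layer_number X" "real (card X) \<le> 441 * real (20 * k) ^ 4"
      using layer_number_lower_bound_construction[of k \<alpha>] assms by (auto simp: k_def)
    define x where "x = real (20 * k)"
    have "x > 0" by (simp add: x_def k_def)
    then have x: "(x ^ 4) powr (3/4) = x ^ 3"
      using powr_powr[of x 4 "3/4"] by (simp add: powr_numeral)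
    have "real (card X) powr (3/4) \<le> (441 * real (20 * k) ^ 4) powr (3/4)"
      using X(4) by (intro powr_mono2) auto
    also have "\<dots> = 441 powr (3/4) * real (20 * k) ^ 3"
      unfolding powr_mult x_def[symmetric] x ..
    also have "\<dots> \<le> 441 powr 1 * real (20 * k) ^ 3"
      by (intro mult_right_mono powr_mono) auto
    also have "\<dots> = 441 * 4000 * real (2 * k ^ 3)" by (simp add: power_mult_distrib)
    also have "\<dots> \<le> 441 * 4000 * real (layer_number X)"
      using X(3) by (intro mult_left_mono of_nat_mono) auto
    finally show ?thesis using X(1,2) by (intro exI[of _ X]) (auto simp: c_def k_def)
  qed
  then show "\<exists>c>0. \<forall>N :: nat. \<exists>X :: (real ^ 2) set. evenly_distributed \<alpha> X \<and> card X \<ge> N \<and>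
      real (layer_number X) \<ge> c * real (card X) powr (3/4)"
    by (intro exI[of _ c]) (auto simp: c_def)
qed

end
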